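(* There is a universal constant $c>0$ such that the following holds. Let $\Omega\subset\mathbb R^d$ be compact, $\mu$ a probability measure on $\Omega$, $X_N$ an $N$-dimensional subspace of $\mathcal C(\Omega)$, $q\in[2,\infty)$, and $H>0$ such that $\|f\|_\infty\le H\|f\|_q$ for all $f\in X_N$. Let $\delta\in(0,1)$. Then for every integer $m\ge c\delta^{-2}q^2H^qN$, if $\xi^1,\dots,\xi^m$ are independent random points in $\Omega$ with distribution $\mu$, $$ \mathbb P\Big(\frac12\|f\|_q^q\le\frac1m\sum_{j=1}^m|f(\xi^j)|^q\le\frac32\|f\|_q^q\quad\forall f\in X_N\Big)\ge1-\delta. $$ In particular, there exist $m$ points $\xi^1,\dots,\xi^m\in\Omega$ such that $\frac12\|f\|_q^q\le\frac1m\sum_{j=1}^m|f(\xi^j)|^q\le\frac32\|f\|_q^q$ for all $f\in X_N$.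
   Context: $\|f\|_q=(\int_\Omega|f|^qd\mu)^{1/q}$ and $\|f\|_\infty=\max_{\mathbf x\in\Omega}|f(\mathbf x)|$. *)

theory Defs
  imports "HOL-Probability.Probability" "HOL-Library.Function_Algebras"
begin

text \<open>Pointwise scalar multiplication on real-valued functions; this, together with the
  pointwise addition from Function_Algebras, makes functions into a real vector space.\<close>
definition fscale :: "real \<Rightarrow> ('a \<Rightarrow> real) \<Rightarrow> ('a \<Rightarrow> real)" where
  "fscale c f = (\<lambda>x. c * f x)"

definition dim_subspace :: "('a \<Rightarrow> real) set \<Rightarrow> nat \<Rightarrow> bool" where
  "dim_subspace X N \<longleftrightarrow>
     (\<exists>B. finite B \<and> card B = N \<and> \<not> module.dependent fscale B \<and> module.span fscale B = X)"

end

(* Chaining in the supremum norm with Bernstein's inequality. The unit ball of X_N in L_q lies in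
   H times the sup-norm unit ball, so at scale H 2^-k it has a sup-norm net of at most exp(C N (k+1))
   points. For f, g in the unit ball with sup-norm distance at most 2 H 2^-k, the increment |f|^q - |g|^q
   is bounded by 2 q H^q 2^-k and, since q >= 2, has second moment at most 8 q^2 H^q 4^-k. It is this
   variance bound that yields H^q rather than H^(2q-2). As m >= c q^2 H^q N / delta^2, a union bound
   over all pairs of consecutive net points makes the k-th link of every chain smaller than
   (3/4)^k / 8, and these sum to 1/2. *)
theory Submission
  imports Defs
begin

text \<open>The net bound is where finite dimension enters, and it is obtained by counting integer
  vectors instead of comparing volumes. A basis of cardinal functions at nodes makes point values
  into coordinates; functions are rescaled and rounded at the nodes, and a doubling property of
  integer balls does the work of homogeneity. The Lebesgue constant \<kappa> of the nodes, over
  which there is no control, only fixes the scale and cancels from the count. The ratio 3/4 comes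
  from the boundedness condition in Bernstein's inequality. Increments at level k have size of order
  2^-k, so the exponential parameter may grow only like 2^k, and a link threshold t_k yields an
  exponent of order 2^k t_k. This must outgrow the linear entropy while t_k stays summable; a ratio
  between 1/2 and 1 achieves both, and 3/4 gives (3/2)^k. The constant is 36864 = 2048 * 18: the
  factor 2048 is lost in the exponent of a single increment, and 18 pays for entropy and failure
  probability. The latter is reached through exp(-1/\<delta>) \<le> \<delta> and 1/\<delta> \<le>
  1/\<delta>^2.\<close>

section \<open>Interpolation nodes and cardinal functions\<close>

lemma vector_space_fscale: "vector_space fscale"
  by unfold_locales (auto simp: fscale_def fun_eq_iff algebra_simps)

text \<open>Induction on \<open>B\<close>: a new generator is either already reproduced by
  interpolation at the current nodes, or there is a point where interpolation fails, and that point
  becomes the next node. In these coordinates a sup-norm bound on a function bounds its coefficients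
  directly, which is what the rounding argument for nets relies on.\<close>

lemma span_lagrange_basis:
  fixes B :: "('a \<Rightarrow> real) set"
  assumes "finite B"
  shows "\<exists>n\<le>card B. \<exists>(p :: nat \<Rightarrow> 'a) u.
           (\<forall>i<n. u i \<in> module.span fscale B) \<and>
           (\<forall>i<n. \<forall>j<n. u i (p j) = of_bool (i = j)) \<and>
           (\<forall>f\<in>module.span fscale B. \<forall>x. f x = (\<Sum>i<n. f (p i) * u i x))"
  using assms
proof (induction B rule: finite_induct)
  case empty
  interpret V: vector_space fscale by (rule vector_space_fscale)
  show ?case by (intro exI[of _ 0]) (auto simp: zero_fun_def)
next
  case (insert b B)
  interpret V: vector_space fscale by (rule vector_space_fscale)
  have fs_span: "(\<lambda>x. f x + c * g x) \<in> V.span S" if "f \<in> V.span S" "g \<in> V.span S" for f g c S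
    using V.span_add[OF that(1) V.span_scale[OF that(2), of c]]
    by (simp add: plus_fun_def fscale_def)
  have sum_span: "(\<lambda>x. \<Sum>i<(k::nat). c i * g i x) \<in> V.span S"
    if "\<forall>i<k. g i \<in> V.span S" for g c k S
    using that
  proof (induction k)
    case 0
    then show ?case using V.span_zero[of S] by (simp add: zero_fun_def)
  next
    case (Suc k)
    then show ?case using fs_span[of "\<lambda>x. \<Sum>i<k. c i * g i x" S "g k" "c k"] by simp
  qed
  obtain n p u where n: "n \<le> card B" and u: "\<forall>i<n. u i \<in> V.span B"
    and delta: "\<forall>i<n. \<forall>j<n. u i (p j) = of_bool (i = j)"
    and repr: "\<forall>f\<in>V.span B. \<forall>x. f x = (\<Sum>i<n. f (p i) * u i x)"
    using insert.IH by blast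
  have mono: "V.span B \<subseteq> V.span (insert b B)" by (rule V.span_mono) auto
  have b: "b \<in> V.span (insert b B)" by (rule V.span_base) auto
  have decomp: "\<exists>c. \<exists>g\<in>V.span B. f = (\<lambda>x. g x + c * b x)" if f: "f \<in> V.span (insert b B)" for f
  proof -
    obtain c where "f - fscale c b \<in> V.span B" using f V.span_breakdown_eq by blast
    then show ?thesis
      by (intro exI[of _ c] bexI[of _ "f - fscale c b"]) (auto simp: fscale_def fun_eq_iff)
  qed
  \<comment> \<open>\<open>w\<close> is the interpolation error of \<open>b\<close>. It vanishes at
    all old nodes, so it can serve as the new direction without disturbing them.\<close>
  define w where "w = (\<lambda>x. b x - (\<Sum>i<n. b (p i) * u i x))"
  show ?case
  proof (cases "\<forall>x. w x = 0")
    case True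
    have "f x = (\<Sum>i<n. f (p i) * u i x)" if f: "f \<in> V.span (insert b B)" for f x
    proof -
      obtain c g where g: "g \<in> V.span B" and fe: "f = (\<lambda>x. g x + c * b x)" using decomp[OF f] by blast
      have "b x = (\<Sum>i<n. b (p i) * u i x)" using spec[OF True, of x] unfolding w_def by linarith
      moreover have "g x = (\<Sum>i<n. g (p i) * u i x)" using repr g by blast
      ultimately have "f x = (\<Sum>i<n. g (p i) * u i x) + c * (\<Sum>i<n. b (p i) * u i x)"
        by (simp add: fe)
      also have "\<dots> = (\<Sum>i<n. f (p i) * u i x)"
        by (simp add: fe sum_distrib_left sum.distrib[symmetric] algebra_simps)
      finally show ?thesis .
    qed
    then show ?thesis using n u delta mono insert.hyps
      by (intro exI[of _ n] conjI exI[of _ p] exI[of _ u]) (auto simp: subset_iff)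
  next
    case False
    then obtain y where y: "w y \<noteq> 0" by blast
    have w_p: "w (p j) = 0" if "j < n" for j
    proof -
      have "(\<Sum>i<n. b (p i) * u i (p j)) = (\<Sum>i<n. if i = j then b (p i) else 0)"
        using that delta by (intro sum.cong) auto
      then show ?thesis using that by (simp add: w_def)
    qed
    have w_span: "w \<in> V.span (insert b B)"
    proof -
      have "(\<lambda>x. \<Sum>i<n. b (p i) * u i x) \<in> V.span (insert b B)"
        using u mono by (intro sum_span) auto
      from fs_span[OF b this, of "-1"] show ?thesis by (simp add: w_def)
    qed
    \<comment> \<open>The old cardinal functions are corrected by a multiple of \<open>w\<close> to
      vanish at the new node \<open>y\<close>; the last one is \<open>w\<close> normalised at
      \<open>y\<close>.\<close>
    define v where "v = (\<lambda>i x. if i < n then u i x - u i y / w y * w x else w x / w y)"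
    define p' where "p' = p(n := y)"
    have v_span: "v i \<in> V.span (insert b B)" if "i < Suc n" for i
    proof (cases "i < n")
      case True
      then show ?thesis using fs_span[OF _ w_span, of "u i" "- u i y / w y"] u mono
        by (auto simp: v_def)
    next
      case False
      then show ?thesis using V.span_scale[OF w_span, of "1 / w y"] by (simp add: v_def fscale_def)
    qed
    have v_delta: "v i (p' j) = of_bool (i = j)" if "i < Suc n" "j < Suc n" for i j
      using that delta y w_p by (auto simp: v_def p'_def less_Suc_eq)
    have v_repr: "f x = (\<Sum>i<Suc n. f (p' i) * v i x)" if f: "f \<in> V.span (insert b B)" for f x
    proof -
      obtain c g where g: "g \<in> V.span B" and fe: "f = (\<lambda>x. g x + c * b x)" using decomp[OF f] by blast
      \<comment> \<open>Interpolation at the old nodes is linear and reproduces the part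
        \<open>g\<close> from \<open>V.span B\<close>, so the error of \<open>f\<close> is
        \<open>c\<close> times that of \<open>b\<close>.\<close>
      have f_eq: "f z = (\<Sum>i<n. f (p i) * u i z) + c * w z" for z
      proof -
        have "g z = (\<Sum>i<n. g (p i) * u i z)" using repr g by blast
        then show ?thesis
          by (simp add: fe w_def sum_distrib_left sum.distrib algebra_simps)
      qed
      have "(\<Sum>i<Suc n. f (p' i) * v i x)
          = (\<Sum>i<n. f (p i) * (u i x - u i y / w y * w x)) + f y * (w x / w y)"
        by (simp add: v_def p'_def)
      also have "\<dots> = (\<Sum>i<n. f (p i) * u i x) + (f y - (\<Sum>i<n. f (p i) * u i y)) * (w x / w y)"
        by (simp add: right_diff_distrib left_diff_distrib sum_subtractf sum_distrib_right sum_divide_distrib diff_divide_distrib mult.assoc)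
      also have "\<dots> = f x" using y by (simp add: f_eq[of y] f_eq[of x])
      finally show ?thesis by simp
    qed
    show ?thesis using n insert.hyps v_span v_delta v_repr
      by (intro exI[of _ "Suc n"] conjI exI[of _ p'] exI[of _ v]) auto
  qed
qed

section \<open>Exponential tails for sums of independent bounded variables\<close>

lemma exp_le_quadratic:
  fixes x :: real
  assumes "\<bar>x\<bar> \<le> 1"
  shows "exp x \<le> 1 + x + x\<^sup>2"
proof (cases "0 \<le> x")
  case True
  then show ?thesis using assms exp_bound by auto
next
  case False
  define y where "y = - x"
  have y: "0 \<le> y" using False by (simp add: y_def)
  have "1 + y \<le> exp y" by simp
  \<comment> \<open>The product equals \<open>1 + y ^ 3\<close>.\<close>
  have "1 \<le> (1 - y + y\<^sup>2) * (1 + y)"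
    using y by (simp add: algebra_simps power2_eq_square)
  also have "\<dots> \<le> (1 - y + y\<^sup>2) * exp y"
  proof (rule mult_left_mono)
    have "0 \<le> (1 - y/2)\<^sup>2 + 3/4 * y\<^sup>2" by simp
    then show "0 \<le> 1 - y + y\<^sup>2" by (simp add: power2_eq_square algebra_simps)
  qed simp
  finally have "exp (-y) \<le> 1 - y + y\<^sup>2" by (simp add: exp_minus field_simps)
  then show ?thesis by (simp add: y_def)
qed

text \<open>Markov's inequality for the exponential moment. Centring at most doubles the bound
  \<open>K\<close>, so \<open>2 * K * l \<le> 1\<close> admits the quadratic estimate of exp; the
  linear term has mean zero and only the variance remains. The parameter \<open>l\<close> is not
  optimised here because chaining chooses it level by level.\<close>

lemma (in prob_space) bernstein_sum_tail:
  fixes h :: "'a \<Rightarrow> real"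
  assumes [measurable]: "h \<in> borel_measurable M"
    and K: "\<And>x. x \<in> space M \<Longrightarrow> \<bar>h x\<bar> \<le> K"
    and v: "(\<integral>x. (h x)\<^sup>2 \<partial>M) \<le> v"
    and l: "0 < l" "2 * K * l \<le> 1"
  shows "measure (PiM {..<m} (\<lambda>_. M))
           {\<xi> \<in> space (PiM {..<m} (\<lambda>_. M)). t \<le> (\<Sum>j<m. h (\<xi> j) - expectation h)}
         \<le> exp (- (l * t) + real m * (l\<^sup>2 * v))"
proof -
  interpret P: prob_space "PiM {..<m} (\<lambda>_. M)" by (intro prob_space_PiM prob_space_axioms)
  interpret product_sigma_finite "\<lambda>_. M" ..
  define g where "g = (\<lambda>x. h x - expectation h)"
  have [measurable]: "g \<in> borel_measurable M" by (simp add: g_def)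
  have int_h: "integrable M h" by (rule integrable_const_bound[where B = K]) (use K in auto)
  have K2: "(h x)\<^sup>2 \<le> K\<^sup>2" if "x \<in> space M" for x
    using K[OF that] by (metis abs_le_square_iff abs_ge_zero abs_of_nonneg order_trans)
  have int_h2: "integrable M (\<lambda>x. (h x)\<^sup>2)"
    by (rule integrable_const_bound[where B = "K\<^sup>2"]) (use K2 in auto)
  have Eh: "\<bar>expectation h\<bar> \<le> K"
  proof -
    have "\<bar>expectation h\<bar> \<le> expectation (\<lambda>x. \<bar>h x\<bar>)" by (rule integral_abs_bound)
    also have "\<dots> \<le> expectation (\<lambda>_. K)"
      using int_h K by (intro integral_mono) auto
    finally show ?thesis by (simp add: prob_space)
  qed
  have g_bd: "\<bar>l * g x\<bar> \<le> 1" if "x \<in> space M" for x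
  proof -
    have "\<bar>g x\<bar> \<le> 2 * K" using K[OF that] Eh by (simp add: g_def)
    then have "l * \<bar>g x\<bar> \<le> l * (2 * K)" using l by (intro mult_left_mono) auto
    also have "\<dots> \<le> 1" using l by (simp add: mult_ac)
    finally show ?thesis using l by (simp add: abs_mult)
  qed
  have int_exp: "integrable M (\<lambda>x. exp (l * g x))"
  proof (rule integrable_const_bound[where B = "exp 1"])
    show "AE x in M. norm (exp (l * g x)) \<le> exp 1"
    proof (rule AE_I2)
      fix x assume "x \<in> space M"
      then have "l * g x \<le> 1" using g_bd[of x] by linarith
      then show "norm (exp (l * g x)) \<le> exp 1" by simp
    qed
  qed simp
  have int_g: "integrable M g" unfolding g_def using int_h by simp
  have Eg: "expectation g = 0" unfolding g_def using int_h by (simp add: prob_space)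
  have g2: "(\<lambda>x. (g x)\<^sup>2) = (\<lambda>x. (h x)\<^sup>2 - 2 * expectation h * h x + (expectation h)\<^sup>2)"
    by (auto simp: g_def power2_eq_square algebra_simps)
  have int_g2: "integrable M (\<lambda>x. (g x)\<^sup>2)" unfolding g2 using int_h int_h2 by simp
  have "expectation (\<lambda>x. (g x)\<^sup>2) = expectation (\<lambda>x. (h x)\<^sup>2) - (expectation h)\<^sup>2"
    unfolding g2 using int_h int_h2 by (simp add: prob_space power2_eq_square)
  then have Eg2: "expectation (\<lambda>x. (g x)\<^sup>2) \<le> v" using v by (smt (verit) zero_le_power2)
  have "expectation (\<lambda>x. exp (l * g x)) \<le> expectation (\<lambda>x. 1 + l * g x + (l * g x)\<^sup>2)"
    using int_exp int_g int_g2 exp_le_quadratic[OF g_bd]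
    by (intro integral_mono) (auto simp: power_mult_distrib)
  also have "\<dots> = 1 + l\<^sup>2 * expectation (\<lambda>x. (g x)\<^sup>2)"
    using int_g int_g2 Eg by (simp add: power_mult_distrib prob_space)
  also have "\<dots> \<le> 1 + l\<^sup>2 * v" using Eg2 by (simp add: mult_left_mono)
  also have "\<dots> \<le> exp (l\<^sup>2 * v)" by simp
  finally have mgf: "expectation (\<lambda>x. exp (l * g x)) \<le> exp (l\<^sup>2 * v)" .
  have exp_sum: "(\<Prod>j<m. exp (l * g (\<xi> j))) = exp (l * (\<Sum>j<m. g (\<xi> j)))" for \<xi> :: "nat \<Rightarrow> 'a"
    by (simp add: exp_sum sum_distrib_left)
  have int_prod: "integrable (PiM {..<m} (\<lambda>_. M)) (\<lambda>\<xi>. exp (l * (\<Sum>j<m. g (\<xi> j))))"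
    using product_integrable_prod[of "{..<m}" "\<lambda>_ x. exp (l * g x)"] int_exp
    by (simp add: exp_sum)
  have "P.expectation (\<lambda>\<xi>. exp (l * (\<Sum>j<m. g (\<xi> j)))) = (\<Prod>j<m. expectation (\<lambda>x. exp (l * g x)))"
    using product_integral_prod[of "{..<m}" "\<lambda>_ x. exp (l * g x)"] int_exp
    by (simp add: exp_sum)
  also have "\<dots> \<le> (\<Prod>j<m. exp (l\<^sup>2 * v))"
    using mgf by (intro prod_mono) auto
  also have "\<dots> = exp (real m * (l\<^sup>2 * v))"
    by (simp add: exp_of_nat_mult)
  finally have mgf_prod: "P.expectation (\<lambda>\<xi>. exp (l * (\<Sum>j<m. g (\<xi> j)))) \<le> exp (real m * (l\<^sup>2 * v))" .
  have "measure (PiM {..<m} (\<lambda>_. M)) {\<xi> \<in> space (PiM {..<m} (\<lambda>_. M)). t \<le> (\<Sum>j<m. g (\<xi> j))}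
      = P.prob {\<xi> \<in> space (PiM {..<m} (\<lambda>_. M)). exp (l * t) \<le> exp (l * (\<Sum>j<m. g (\<xi> j)))}"
    using l by simp
  also have "\<dots> \<le> P.expectation (\<lambda>\<xi>. exp (l * (\<Sum>j<m. g (\<xi> j)))) / exp (l * t)"
    using int_prod by (intro integral_Markov_inequality_measure[where A = "{}"]) auto
  also have "\<dots> \<le> exp (real m * (l\<^sup>2 * v)) / exp (l * t)"
    using mgf_prod by (intro divide_right_mono) auto
  also have "\<dots> = exp (- (l * t) + real m * (l\<^sup>2 * v))"
    by (simp add: exp_diff[symmetric])
  finally show ?thesis by (simp add: g_def)
qed

text \<open>Mean value theorem for the power function on the nonnegative axis. The pointwise maximum
  is kept, rather than a uniform bound, because the variance estimate still has to integrate part of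
  it.\<close>

lemma abs_powr_diff_le:
  fixes a b q :: real
  assumes "1 \<le> q"
  shows "\<bar>\<bar>a\<bar> powr q - \<bar>b\<bar> powr q\<bar> \<le> q * \<bar>a - b\<bar> * max \<bar>a\<bar> \<bar>b\<bar> powr (q - 1)"
proof -
  have *: "y powr q - x powr q \<le> q * (y - x) * y powr (q - 1)" if "0 \<le> x" "x \<le> y" for x y :: real
  proof (cases "x = y")
    case False
    then have "x < y" using that by simp
    have cont: "continuous_on {x..y} (\<lambda>t. t powr q)"
      using that assms by (intro continuous_on_powr' continuous_intros) force+
    have deriv: "((\<lambda>t. t powr q) has_derivative (\<lambda>d. d * (q * z powr (q - 1)))) (at z)" if "x < z" for z
      using has_real_derivative_powr[of z q] \<open>0 \<le> x\<close> that
      unfolding has_field_derivative_def by (simp add: mult.commute[of _ "q * z powr (q - 1)"])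
    obtain z where z: "x < z" "z < y" and eq: "y powr q - x powr q = (y - x) * (q * z powr (q - 1))"
      using mvt[OF \<open>x < y\<close> cont deriv] by blast
    have "z powr (q - 1) \<le> y powr (q - 1)" using z that assms by (intro powr_mono2) auto
    then have "(y - x) * (q * z powr (q - 1)) \<le> (y - x) * (q * y powr (q - 1))"
      using \<open>x < y\<close> assms by (intro mult_left_mono) auto
    then show ?thesis by (simp add: eq mult_ac)
  qed simp
  have **: "\<bar>y powr q - x powr q\<bar> \<le> q * \<bar>y - x\<bar> * max y x powr (q - 1)" if "0 \<le> x" "x \<le> y" for x y :: real
    using *[OF that] powr_mono2[of q x y] that assms by (simp add: max_def)
  have "\<bar>\<bar>a\<bar> powr q - \<bar>b\<bar> powr q\<bar> \<le> q * \<bar>\<bar>a\<bar> - \<bar>b\<bar>\<bar> * max \<bar>a\<bar> \<bar>b\<bar> powr (q - 1)"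
    using **[of "\<bar>a\<bar>" "\<bar>b\<bar>"] **[of "\<bar>b\<bar>" "\<bar>a\<bar>"]
    by (cases "\<bar>a\<bar> \<le> \<bar>b\<bar>") (auto simp: abs_minus_commute max.commute)
  also have "\<dots> \<le> q * \<bar>a - b\<bar> * max \<bar>a\<bar> \<bar>b\<bar> powr (q - 1)"
    using assms by (intro mult_right_mono mult_left_mono) auto
  finally show ?thesis .
qed

section \<open>Sup-norm nets by counting integer points\<close>

text \<open>\<open>\<kappa>\<close> bounds the Lebesgue function of the nodes: errors of at most 1
  in the nodal values change the function by at most \<open>\<kappa>\<close> on
  \<open>\<Omega>\<close>.\<close>

locale lagrange_basis =
  fixes \<Omega> :: "'a set" and X :: "('a \<Rightarrow> real) set" and n :: nat
    and p :: "nat \<Rightarrow> 'a" and u :: "nat \<Rightarrow> 'a \<Rightarrow> real" and \<kappa> :: real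
  assumes nodes: "i < n \<Longrightarrow> p i \<in> \<Omega>"
    and delta: "i < n \<Longrightarrow> j < n \<Longrightarrow> u i (p j) = of_bool (i = j)"
    and repr: "f \<in> X \<Longrightarrow> f x = (\<Sum>i<n. f (p i) * u i x)"
    and \<kappa>_pos: "0 < \<kappa>"
    and lebesgue_bound: "x \<in> \<Omega> \<Longrightarrow> (\<Sum>i<n. \<bar>u i x\<bar>) \<le> \<kappa>"
begin

text \<open>The integer points of a sup-norm ball, written in nodal coordinates. Extensionality
  identifies a vector with its first \<open>n\<close> entries, without which the set could not be
  finite.\<close>

definition lattice_ball :: "real \<Rightarrow> (nat \<Rightarrow> int) set" where
  "lattice_ball t = {z \<in> extensional {..<n}. \<forall>x\<in>\<Omega>. \<bar>\<Sum>i<n. of_int (z i) * u i x\<bar> \<le> t}"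

lemma finite_lattice_ball: "finite (lattice_ball t)"
proof (rule finite_subset)
  show "lattice_ball t \<subseteq> PiE {..<n} (\<lambda>_. {- \<lceil>t\<rceil>..\<lceil>t\<rceil>})"
  proof
    fix z assume z: "z \<in> lattice_ball t"
    have "z j \<in> {- \<lceil>t\<rceil>..\<lceil>t\<rceil>}" if j: "j < n" for j
    proof -
      have "(\<Sum>i<n. of_int (z i) * u i (p j)) = (\<Sum>i<n. if i = j then of_int (z i) else (0::real))"
        using j by (intro sum.cong) (auto simp: delta)
      also have "\<dots> = of_int (z j)" using j by simp
      finally have "\<bar>of_int (z j)\<bar> \<le> t"
        using z nodes[OF j] by (auto simp: lattice_ball_def)
      then have "of_int \<bar>z j\<bar> \<le> t" by simp
      then have "\<bar>z j\<bar> \<le> \<lceil>t\<rceil>" by linarith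
      then show ?thesis by auto
    qed
    then show "z \<in> PiE {..<n} (\<lambda>_. {- \<lceil>t\<rceil>..\<lceil>t\<rceil>})"
      using z by (auto simp: lattice_ball_def PiE_def)
  qed
qed (auto intro: finite_PiE)

lemma zero_in_lattice_ball: "0 \<le> t \<Longrightarrow> (\<lambda>i\<in>{..<n}. 0) \<in> lattice_ball t"
  by (auto simp: lattice_ball_def)

text \<open>Two lattice points congruent modulo 4 differ by four times a lattice point, so there are at
  most \<open>4 ^ n\<close> residue classes, each no larger than the lattice ball of half the radius. This
  doubling property plays the role of the scaling of Lebesgue measure in the usual volumetric
  bound for packing numbers.\<close>
lemma card_lattice_ball_double: "card (lattice_ball (2 * t)) \<le> 4 ^ n * card (lattice_ball t)"
proof -
  define r where "r = (\<lambda>z :: nat \<Rightarrow> int. \<lambda>i\<in>{..<n}. z i mod 4)"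
  define R where "R = PiE {..<n} (\<lambda>_. {0..<4::int})"
  have finR: "finite R" by (auto simp: R_def intro: finite_PiE)
  have cardR: "card R = 4 ^ n" by (simp add: R_def card_PiE)
  have fibre: "card {z \<in> lattice_ball (2 * t). r z = c} \<le> card (lattice_ball t)" for c
  proof (cases "{z \<in> lattice_ball (2 * t). r z = c} = {}")
    case False
    then obtain w where w: "w \<in> lattice_ball (2 * t)" "r w = c" by blast
    define \<phi> where "\<phi> = (\<lambda>z :: nat \<Rightarrow> int. \<lambda>i\<in>{..<n}. (z i - w i) div 4)"
    have step: "z i = w i + 4 * \<phi> z i" if "r z = c" "i < n" for z i
    proof -
      have "r z i = r w i" using that(1) w(2) by simp
      then have "z i mod 4 = w i mod 4" using that(2) by (simp add: r_def)
      then have "4 dvd z i - w i" by (simp add: mod_eq_dvd_iff)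
      then show ?thesis using that by (simp add: \<phi>_def)
    qed
    show ?thesis
    proof (rule card_inj_on_le)
      show "inj_on \<phi> {z \<in> lattice_ball (2 * t). r z = c}"
      proof (rule inj_onI)
        fix z z' assume z: "z \<in> {z \<in> lattice_ball (2 * t). r z = c}"
          "z' \<in> {z \<in> lattice_ball (2 * t). r z = c}" and eq: "\<phi> z = \<phi> z'"
        show "z = z'"
        proof (rule extensionalityI[of _ "{..<n}"])
          fix i assume "i \<in> {..<n}"
          then show "z i = z' i" using step[of z i] step[of z' i] z eq by simp
        qed (use z in \<open>auto simp: lattice_ball_def\<close>)
      qed
      show "\<phi> ` {z \<in> lattice_ball (2 * t). r z = c} \<subseteq> lattice_ball t"
      proof clarify
        fix z assume z: "z \<in> lattice_ball (2 * t)" and c: "c = r z"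
        have "\<bar>\<Sum>i<n. of_int (\<phi> z i) * u i x\<bar> \<le> t" if x: "x \<in> \<Omega>" for x
        proof -
          have "(\<Sum>i<n. of_int (z i) * u i x)
              = (\<Sum>i<n. of_int (w i) * u i x + 4 * (of_int (\<phi> z i) * u i x))"
            using step[of z] c by (intro sum.cong) (auto simp: algebra_simps)
          also have "\<dots> = (\<Sum>i<n. of_int (w i) * u i x) + 4 * (\<Sum>i<n. of_int (\<phi> z i) * u i x)"
            by (simp add: sum.distrib sum_distrib_left)
          \<comment> \<open>Both sums over \<open>z\<close> and \<open>w\<close> are at most
            \<open>2 * t\<close> in absolute value, hence four times the quotient is at most
            \<open>4 * t\<close>; the modulus 4 is chosen for this.\<close>
          finally show ?thesis using z w x by (fastforce simp: lattice_ball_def)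
        qed
        then show "\<phi> z \<in> lattice_ball t" by (auto simp: lattice_ball_def \<phi>_def)
      qed
    qed (rule finite_lattice_ball)
  next
    case True
    then show ?thesis by (simp only: card.empty)
  qed
  have "lattice_ball (2 * t) \<subseteq> (\<Union>c\<in>R. {z \<in> lattice_ball (2 * t). r z = c})"
    by (auto simp: R_def r_def)
  then have "card (lattice_ball (2 * t)) \<le> card (\<Union>c\<in>R. {z \<in> lattice_ball (2 * t). r z = c})"
    using finR finite_lattice_ball by (intro card_mono) auto
  also have "\<dots> \<le> (\<Sum>c\<in>R. card {z \<in> lattice_ball (2 * t). r z = c})"
    by (rule card_UN_le[OF finR])
  also have "\<dots> \<le> (\<Sum>c\<in>R. card (lattice_ball t))"
    by (intro sum_mono fibre)
  finally show ?thesis by (simp add: cardR)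
qed

lemma card_lattice_ball_power2: "card (lattice_ball (2 ^ k * t)) \<le> 4 ^ (n * k) * card (lattice_ball t)"
proof (induction k)
  case (Suc k)
  have "card (lattice_ball (2 ^ Suc k * t)) \<le> 4 ^ n * card (lattice_ball (2 ^ k * t))"
    using card_lattice_ball_double[of "2 ^ k * t"] by (simp add: mult.assoc)
  also have "\<dots> \<le> 4 ^ n * (4 ^ (n * k) * card (lattice_ball t))"
    using Suc.IH by simp
  finally show ?case by (simp add: power_add)
qed simp

text \<open>The packing argument with counting in place of volume. Translates of
  \<open>lattice_ball \<kappa>\<close> by the rounded, rescaled members of \<open>A\<close> are
  disjoint and lie in the ball of radius \<open>2 ^ (k + 3) * \<kappa>\<close>. Doubling
  \<open>k + 3\<close> times compares the two balls, and the unknown size of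
  \<open>lattice_ball \<kappa>\<close> cancels.\<close>

lemma card_separated_le:
  assumes A: "A \<subseteq> X" "finite A" and R: "0 < R" "\<And>f x. f \<in> A \<Longrightarrow> x \<in> \<Omega> \<Longrightarrow> \<bar>f x\<bar> \<le> R"
    and sep: "\<And>f g. f \<in> A \<Longrightarrow> g \<in> A \<Longrightarrow> f \<noteq> g \<Longrightarrow> \<exists>x\<in>\<Omega>. R / 2 ^ k < \<bar>f x - g x\<bar>"
  shows "card A \<le> 4 ^ (n * (k + 3))"
proof -
  \<comment> \<open>The scale at which the separation \<open>R / 2 ^ k\<close> becomes
    \<open>4 * \<kappa>\<close>, which is exactly two rounding errors plus two ball radii.\<close>
  define \<tau> where "\<tau> = 4 * \<kappa> * 2 ^ k / R"
  have \<tau>: "0 < \<tau>" "\<tau> * R = 4 * \<kappa> * 2 ^ k" using R \<kappa>_pos by (auto simp: \<tau>_def)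
  define z where "z = (\<lambda>f i. \<lfloor>\<tau> * f (p i)\<rfloor>)"
  define \<phi> where "\<phi> = (\<lambda>(f, w :: nat \<Rightarrow> int). \<lambda>i\<in>{..<n}. z f i + w i)"
  have round: "\<bar>\<tau> * f x - (\<Sum>i<n. of_int (z f i) * u i x)\<bar> \<le> \<kappa>" if "f \<in> X" "x \<in> \<Omega>" for f x
  proof -
    have "\<tau> * f x = (\<Sum>i<n. \<tau> * f (p i) * u i x)"
      by (subst repr[OF that(1)]) (simp add: sum_distrib_left mult.assoc)
    then have "\<bar>\<tau> * f x - (\<Sum>i<n. of_int (z f i) * u i x)\<bar>
        = \<bar>\<Sum>i<n. (\<tau> * f (p i) - of_int (z f i)) * u i x\<bar>"
      by (simp add: sum_subtractf left_diff_distrib)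
    also have "\<dots> \<le> (\<Sum>i<n. \<bar>(\<tau> * f (p i) - of_int (z f i)) * u i x\<bar>)" by (rule sum_abs)
    also have "\<dots> \<le> (\<Sum>i<n. \<bar>u i x\<bar>)"
    proof (rule sum_mono)
      fix i
      have "\<bar>\<tau> * f (p i) - of_int (z f i)\<bar> \<le> 1" unfolding z_def by linarith
      then show "\<bar>(\<tau> * f (p i) - of_int (z f i)) * u i x\<bar> \<le> \<bar>u i x\<bar>"
        by (simp add: abs_mult mult_left_le_one_le)
    qed
    also have "\<dots> \<le> \<kappa>" by (rule lebesgue_bound[OF that(2)])
    finally show ?thesis .
  qed
  have \<phi>_sum: "(\<Sum>i<n. of_int (\<phi> (f, w) i) * u i x)
      = (\<Sum>i<n. of_int (z f i) * u i x) + (\<Sum>i<n. of_int (w i) * u i x)" for f w x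
    by (simp add: \<phi>_def sum.distrib[symmetric] algebra_simps)
  have "inj_on \<phi> (A \<times> lattice_ball \<kappa>)"
  proof (rule inj_onI, clarify)
    fix f w g v
    assume f: "f \<in> A" and g: "g \<in> A" and w: "w \<in> lattice_ball \<kappa>" and v: "v \<in> lattice_ball \<kappa>"
      and eq: "\<phi> (f, w) = \<phi> (g, v)"
    have "\<bar>f x - g x\<bar> \<le> R / 2 ^ k" if x: "x \<in> \<Omega>" for x
    proof -
      have "\<bar>\<Sum>i<n. of_int (w i) * u i x\<bar> \<le> \<kappa>" "\<bar>\<Sum>i<n. of_int (v i) * u i x\<bar> \<le> \<kappa>"
        using w v x by (auto simp: lattice_ball_def)
      moreover have "\<bar>\<tau> * f x - (\<Sum>i<n. of_int (z f i) * u i x)\<bar> \<le> \<kappa>"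
        "\<bar>\<tau> * g x - (\<Sum>i<n. of_int (z g i) * u i x)\<bar> \<le> \<kappa>"
        using f g A x by (auto intro!: round)
      moreover have "(\<Sum>i<n. of_int (z f i) * u i x) + (\<Sum>i<n. of_int (w i) * u i x)
          = (\<Sum>i<n. of_int (z g i) * u i x) + (\<Sum>i<n. of_int (v i) * u i x)"
        unfolding \<phi>_sum[symmetric] eq ..
      ultimately have "\<bar>\<tau> * f x - \<tau> * g x\<bar> \<le> 4 * \<kappa>" by linarith
      then have "\<tau> * \<bar>f x - g x\<bar> \<le> \<tau> * (R / 2 ^ k)"
        using \<tau> by (simp add: right_diff_distrib[symmetric] abs_mult)
      then show ?thesis by (rule mult_left_le_imp_le) (rule \<tau>(1))
    qed
    then have fg: "f = g" using sep[OF f g] by force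
    have "w = v"
    proof (rule extensionalityI[of _ "{..<n}"])
      fix i assume "i \<in> {..<n}"
      then show "w i = v i" using fun_cong[OF eq, of i] fg by (simp add: \<phi>_def)
    qed (use w v in \<open>auto simp: lattice_ball_def\<close>)
    with fg show "f = g \<and> w = v" by simp
  qed
  moreover have "\<phi> ` (A \<times> lattice_ball \<kappa>) \<subseteq> lattice_ball (2 ^ (k + 3) * \<kappa>)"
  proof (rule image_subsetI, clarify)
    fix f w assume f: "f \<in> A" and w: "w \<in> lattice_ball \<kappa>"
    have "\<bar>\<Sum>i<n. of_int (\<phi> (f, w) i) * u i x\<bar> \<le> 2 ^ (k + 3) * \<kappa>" if x: "x \<in> \<Omega>" for x
    proof -
      have "\<bar>\<Sum>i<n. of_int (w i) * u i x\<bar> \<le> \<kappa>" using w x by (auto simp: lattice_ball_def)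
      moreover have "\<bar>\<tau> * f x - (\<Sum>i<n. of_int (z f i) * u i x)\<bar> \<le> \<kappa>"
        using f A x by (auto intro!: round)
      moreover have "\<bar>\<tau> * f x\<bar> \<le> 4 * \<kappa> * 2 ^ k"
      proof -
        have "\<tau> * \<bar>f x\<bar> \<le> \<tau> * R" using \<tau>(1) R(2)[OF f x] by (intro mult_left_mono) auto
        then show ?thesis using \<tau> by (simp add: abs_mult)
      qed
      \<comment> \<open>The size of the scaled function, plus \<open>\<kappa>\<close> for rounding
        and \<open>\<kappa>\<close> for the translated ball.\<close>
      ultimately have "\<bar>\<Sum>i<n. of_int (\<phi> (f, w) i) * u i x\<bar> \<le> 4 * \<kappa> * 2 ^ k + 2 * \<kappa>"
        unfolding \<phi>_sum by linarith
      also have "\<dots> \<le> 2 ^ (k + 3) * \<kappa>"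
      proof -
        have "2 * \<kappa> * 1 \<le> 2 * \<kappa> * 2 ^ k" using \<kappa>_pos by (intro mult_left_mono) auto
        moreover have "0 < \<kappa> * 2 ^ k" using \<kappa>_pos by simp
        ultimately show ?thesis by (simp add: power_add)
      qed
      finally show ?thesis .
    qed
    then show "\<phi> (f, w) \<in> lattice_ball (2 ^ (k + 3) * \<kappa>)"
      by (simp add: lattice_ball_def) (simp add: \<phi>_def)
  qed
  ultimately have "card (A \<times> lattice_ball \<kappa>) \<le> card (lattice_ball (2 ^ (k + 3) * \<kappa>))"
    by (rule card_inj_on_le[OF _ _ finite_lattice_ball])
  also have "\<dots> \<le> 4 ^ (n * (k + 3)) * card (lattice_ball \<kappa>)"
    by (rule card_lattice_ball_power2)
  finally have "card A * card (lattice_ball \<kappa>) \<le> 4 ^ (n * (k + 3)) * card (lattice_ball \<kappa>)"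
    by (simp add: card_cartesian_product)
  moreover have "0 < card (lattice_ball \<kappa>)"
    using zero_in_lattice_ball[of \<kappa>] \<kappa>_pos finite_lattice_ball[of \<kappa>] by (auto simp: card_gt_0_iff)
  ultimately show ?thesis by simp
qed

text \<open>A separated subset of greatest cardinality is a net, since any uncovered point could be
  added to it; the packing bound ensures that one exists. The net lies inside \<open>F\<close>, so
  its members inherit the norm bounds.\<close>

lemma exists_net:
  assumes F: "F \<subseteq> X" and R: "0 < R" "\<And>f x. f \<in> F \<Longrightarrow> x \<in> \<Omega> \<Longrightarrow> \<bar>f x\<bar> \<le> R"
  shows "\<exists>T\<subseteq>F. finite T \<and> card T \<le> 4 ^ (n * (k + 3)) \<and>
           (\<forall>f\<in>F. \<exists>g\<in>T. \<forall>x\<in>\<Omega>. \<bar>f x - g x\<bar> \<le> R / 2 ^ k)"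
proof -
  define P where "P = (\<lambda>A. A \<subseteq> F \<and> finite A \<and>
    (\<forall>f\<in>A. \<forall>g\<in>A. f \<noteq> g \<longrightarrow> (\<exists>x\<in>\<Omega>. R / 2 ^ k < \<bar>f x - g x\<bar>)))"
  have bound: "card A \<le> 4 ^ (n * (k + 3))" if "P A" for A
    using that F R by (intro card_separated_le[of A R k]) (auto simp: P_def)
  have "P {}" by (simp add: P_def)
  then have "\<exists>T. P T \<and> (\<forall>A. P A \<longrightarrow> card A \<le> card T)"
    by (rule ex_has_greatest_nat[where b = "Suc (4 ^ (n * (k + 3)))"])
      (simp only: less_Suc_eq_le, intro allI impI, rule bound)
  then obtain T where T: "P T" and max: "\<And>A. P A \<Longrightarrow> card A \<le> card T"
    by auto
  have "\<exists>g\<in>T. \<forall>x\<in>\<Omega>. \<bar>f x - g x\<bar> \<le> R / 2 ^ k" if f: "f \<in> F" for f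
  proof (rule ccontr)
    assume neg: "\<not> ?thesis"
    then have far: "\<exists>x\<in>\<Omega>. R / 2 ^ k < \<bar>f x - g x\<bar>" if "g \<in> T" for g
      using that by (auto simp: not_le)
    have "f \<notin> T"
    proof
      assume "f \<in> T"
      then have "R / 2 ^ k < 0" using far[of f] by simp
      then show False using R(1) by (simp add: divide_less_0_iff)
    qed
    moreover have "P (insert f T)"
      unfolding P_def
    proof (intro conjI ballI impI)
      fix g h assume gh: "g \<in> insert f T" "h \<in> insert f T" "g \<noteq> h"
      then consider "g = f" "h \<in> T" | "h = f" "g \<in> T" | "g \<in> T" "h \<in> T" by blast
      then show "\<exists>x\<in>\<Omega>. R / 2 ^ k < \<bar>g x - h x\<bar>"
      proof cases
        case 2
        then show ?thesis using far[of g] by (simp add: abs_minus_commute)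
      next
        case 3
        then show ?thesis using T gh(3) unfolding P_def by blast
      qed (use far[of h] in simp)
    qed (use T f in \<open>auto simp: P_def\<close>)
    ultimately show False using max[of "insert f T"] T by (simp add: P_def)
  qed
  then show ?thesis using T bound[OF T] by (intro exI[of _ T] conjI ballI) (auto simp: P_def)
qed

end

section \<open>Tails of the increments of q-th powers\<close>

lemma abs_powr_diff_le_bounded:
  fixes a b q H :: real
  assumes "1 \<le> q" "\<bar>a\<bar> \<le> H" "\<bar>b\<bar> \<le> H"
  shows "\<bar>\<bar>a\<bar> powr q - \<bar>b\<bar> powr q\<bar> \<le> q * \<bar>a - b\<bar> * H powr (q - 1)"
proof -
  have "\<bar>\<bar>a\<bar> powr q - \<bar>b\<bar> powr q\<bar> \<le> q * \<bar>a - b\<bar> * max \<bar>a\<bar> \<bar>b\<bar> powr (q - 1)"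
    by (rule abs_powr_diff_le) fact
  also have "\<dots> \<le> q * \<bar>a - b\<bar> * H powr (q - 1)"
    using assms by (intro mult_left_mono powr_mono2) auto
  finally show ?thesis .
qed

text \<open>The squared derivative bound carries the power \<open>2 * q - 2\<close> of the pointwise
  maximum, split as \<open>q - 2\<close> plus \<open>q\<close>. The sup bound \<open>H\<close> is
  spent on the first factor only; the second is left to be integrated, where the moment bounds make
  it a constant. The assumption on \<open>q\<close> keeps the exponent \<open>q - 2\<close>
  nonnegative.\<close>

lemma abs_powr_diff_square_le:
  fixes a b q H :: real
  assumes "2 \<le> q" "\<bar>a\<bar> \<le> H" "\<bar>b\<bar> \<le> H"
  shows "(\<bar>a\<bar> powr q - \<bar>b\<bar> powr q)\<^sup>2 \<le> q\<^sup>2 * (a - b)\<^sup>2 * H powr (q - 2) * (\<bar>a\<bar> powr q + \<bar>b\<bar> powr q)"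
proof -
  define s where "s = max \<bar>a\<bar> \<bar>b\<bar>"
  have s: "0 \<le> s" "s \<le> H" "s powr q \<le> \<bar>a\<bar> powr q + \<bar>b\<bar> powr q"
    using assms by (auto simp: s_def max_def)
  have "(\<bar>a\<bar> powr q - \<bar>b\<bar> powr q)\<^sup>2 \<le> (q * \<bar>a - b\<bar> * s powr (q - 1))\<^sup>2"
    using abs_powr_diff_le[of q a b] assms
    by (intro power2_le_iff_abs_le[THEN iffD2]) (auto simp: s_def)
  also have "\<dots> = q\<^sup>2 * (a - b)\<^sup>2 * (s powr (q - 1))\<^sup>2"
    by (simp add: power_mult_distrib)
  also have "(s powr (q - 1))\<^sup>2 = s powr (q - 2) * s powr q"
    by (simp add: power2_eq_square powr_add[symmetric])
  also have "q\<^sup>2 * (a - b)\<^sup>2 * (s powr (q - 2) * s powr q)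
      \<le> q\<^sup>2 * (a - b)\<^sup>2 * (H powr (q - 2) * (\<bar>a\<bar> powr q + \<bar>b\<bar> powr q))"
    using s assms by (intro mult_left_mono[OF mult_mono] powr_mono2) auto
  finally show ?thesis by (simp add: mult.assoc)
qed

lemma (in prob_space) integrable_abs_powr:
  fixes f :: "'a \<Rightarrow> real"
  assumes [measurable]: "f \<in> borel_measurable M"
    and "0 \<le> q" "\<And>x. x \<in> space M \<Longrightarrow> \<bar>f x\<bar> \<le> H"
  shows "integrable M (\<lambda>x. \<bar>f x\<bar> powr q)"
  by (rule integrable_const_bound[where B = "H powr q"])
     (use assms in \<open>auto intro!: powr_mono2\<close>)

text \<open>Bernstein's bound for \<open>h\<close> and for \<open>- h\<close>, hence the factor 2.
  The distance \<open>D\<close> enters the boundedness condition linearly but the variance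
  quadratically.\<close>

lemma (in prob_space) increment_tail:
  fixes f g :: "'a \<Rightarrow> real"
  assumes f [measurable]: "f \<in> borel_measurable M" and g [measurable]: "g \<in> borel_measurable M"
    and bound: "\<And>x. x \<in> space M \<Longrightarrow> \<bar>f x\<bar> \<le> H" "\<And>x. x \<in> space M \<Longrightarrow> \<bar>g x\<bar> \<le> H"
    and D: "\<And>x. x \<in> space M \<Longrightarrow> \<bar>f x - g x\<bar> \<le> D"
    and moment: "expectation (\<lambda>x. \<bar>f x\<bar> powr q) \<le> 1" "expectation (\<lambda>x. \<bar>g x\<bar> powr q) \<le> 1"
    and q: "2 \<le> q" and l: "0 < l" "2 * (q * D * H powr (q - 1)) * l \<le> 1"
  defines "h \<equiv> \<lambda>x. \<bar>f x\<bar> powr q - \<bar>g x\<bar> powr q"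
  shows "measure (PiM {..<m} (\<lambda>_. M))
           {\<xi> \<in> space (PiM {..<m} (\<lambda>_. M)). t \<le> \<bar>\<Sum>j<m. h (\<xi> j) - expectation h\<bar>}
         \<le> 2 * exp (- (l * t) + real m * (l\<^sup>2 * (2 * q\<^sup>2 * D\<^sup>2 * H powr (q - 2))))"
proof -
  interpret P: prob_space "PiM {..<m} (\<lambda>_. M)" by (intro prob_space_PiM prob_space_axioms)
  have [measurable]: "h \<in> borel_measurable M" by (simp add: h_def)
  have int: "integrable M (\<lambda>x. \<bar>f x\<bar> powr q)" "integrable M (\<lambda>x. \<bar>g x\<bar> powr q)"
    using q bound by (auto intro!: integrable_abs_powr)
  have h_bound: "\<bar>h x\<bar> \<le> q * D * H powr (q - 1)" if "x \<in> space M" for x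
  proof -
    have "\<bar>h x\<bar> \<le> q * \<bar>f x - g x\<bar> * H powr (q - 1)"
      unfolding h_def using that q bound by (intro abs_powr_diff_le_bounded) auto
    also have "\<dots> \<le> q * D * H powr (q - 1)"
      using that q D by (intro mult_right_mono mult_left_mono) auto
    finally show ?thesis .
  qed
  have "expectation (\<lambda>x. (h x)\<^sup>2)
      \<le> expectation (\<lambda>x. q\<^sup>2 * D\<^sup>2 * H powr (q - 2) * (\<bar>f x\<bar> powr q + \<bar>g x\<bar> powr q))"
  proof (rule integral_mono_AE')
    show "AE x in M. (h x)\<^sup>2 \<le> q\<^sup>2 * D\<^sup>2 * H powr (q - 2) * (\<bar>f x\<bar> powr q + \<bar>g x\<bar> powr q)"
    proof (rule AE_I2)
      fix x assume x: "x \<in> space M"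
      have "(h x)\<^sup>2 \<le> q\<^sup>2 * (f x - g x)\<^sup>2 * H powr (q - 2) * (\<bar>f x\<bar> powr q + \<bar>g x\<bar> powr q)"
        unfolding h_def using q bound x by (intro abs_powr_diff_square_le) auto
      also have "(f x - g x)\<^sup>2 \<le> D\<^sup>2"
        using D[OF x] by (intro power2_le_iff_abs_le[THEN iffD2]) auto
      finally show "(h x)\<^sup>2 \<le> q\<^sup>2 * D\<^sup>2 * H powr (q - 2) * (\<bar>f x\<bar> powr q + \<bar>g x\<bar> powr q)"
        by (simp add: mult_right_mono mult_left_mono)
    qed
  qed (use int in auto)
  also have "\<dots> = q\<^sup>2 * D\<^sup>2 * H powr (q - 2) *
      (expectation (\<lambda>x. \<bar>f x\<bar> powr q) + expectation (\<lambda>x. \<bar>g x\<bar> powr q))"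
    using int by simp
  also have "\<dots> \<le> q\<^sup>2 * D\<^sup>2 * H powr (q - 2) * 2"
    using moment by (intro mult_left_mono) auto
  finally have var: "expectation (\<lambda>x. (h x)\<^sup>2) \<le> 2 * q\<^sup>2 * D\<^sup>2 * H powr (q - 2)" by simp
  let ?U = "{\<xi> \<in> space (PiM {..<m} (\<lambda>_. M)). t \<le> (\<Sum>j<m. h (\<xi> j) - expectation h)}"
  let ?L = "{\<xi> \<in> space (PiM {..<m} (\<lambda>_. M)).
      t \<le> (\<Sum>j<m. (\<lambda>x. - h x) (\<xi> j) - expectation (\<lambda>x. - h x))}"
  let ?e = "exp (- (l * t) + real m * (l\<^sup>2 * (2 * q\<^sup>2 * D\<^sup>2 * H powr (q - 2))))"
  have "P.prob ?U \<le> ?e"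
    using h_bound var l by (intro bernstein_sum_tail) auto
  moreover have "P.prob ?L \<le> ?e"
    using h_bound var l by (intro bernstein_sum_tail) auto
  moreover have "P.prob {\<xi> \<in> space (PiM {..<m} (\<lambda>_. M)). t \<le> \<bar>\<Sum>j<m. h (\<xi> j) - expectation h\<bar>}
      \<le> P.prob (?U \<union> ?L)"
  proof (rule P.finite_measure_mono)
    show "{\<xi> \<in> space (PiM {..<m} (\<lambda>_. M)). t \<le> \<bar>\<Sum>j<m. h (\<xi> j) - expectation h\<bar>} \<subseteq> ?U \<union> ?L"
      by (auto simp: sum_subtractf sum_negf abs_if split: if_splits)
  qed measurable
  moreover have "P.prob (?U \<union> ?L) \<le> P.prob ?U + P.prob ?L"
    by (rule measure_Un_le) measurable
  ultimately show ?thesis by linarith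
qed

section \<open>The chaining argument\<close>

text \<open>Carries estimates along a sequence of net points over to its limit; the uniform bound
  \<open>H\<close> supplies a constant dominating function.\<close>

lemma (in prob_space) expectation_abs_powr_tendsto:
  fixes f :: "'a \<Rightarrow> real"
  assumes meas: "\<And>k. F k \<in> borel_measurable M" and f: "f \<in> borel_measurable M"
    and bound: "\<And>k x. x \<in> space M \<Longrightarrow> \<bar>F k x\<bar> \<le> H"
    and lim: "\<And>x. x \<in> space M \<Longrightarrow> (\<lambda>k. F k x) \<longlonglongrightarrow> f x"
    and q: "0 < q"
  shows "(\<lambda>k. expectation (\<lambda>x. \<bar>F k x\<bar> powr q)) \<longlonglongrightarrow> expectation (\<lambda>x. \<bar>f x\<bar> powr q)"
proof (rule integral_dominated_convergence[where w = "\<lambda>_. H powr q"])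
  show "AE x in M. (\<lambda>k. \<bar>F k x\<bar> powr q) \<longlonglongrightarrow> \<bar>f x\<bar> powr q"
    using lim q by (intro AE_I2 tendsto_powr' tendsto_intros) auto
  show "AE x in M. norm (\<bar>F k x\<bar> powr q) \<le> H powr q" for k
    using bound q by (intro AE_I2) (auto intro!: powr_mono2)
qed (use meas f in auto)

text \<open>The bound is summable in \<open>k\<close> because the entropy grows linearly in \<open>k\<close> while the exponent
  grows like \<open>(3 / 2) ^ k\<close>.\<close>
lemma chaining_level_bound:
  fixes \<delta> y :: real
  assumes N: "1 \<le> N" and \<delta>: "0 < \<delta>" "\<delta> < 1" and y: "18 * real N * (3/2) ^ k / \<delta>\<^sup>2 \<le> y"
  shows "4 ^ (N * (k + 3)) * 4 ^ (N * (k + 4)) * (2 * exp (- y)) \<le> \<delta> * (1/2) ^ Suc k"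
proof -
  have e1: "2 \<le> exp (1::real)" using exp_ge_add_one_self[of 1] by simp
  have e2: "4 \<le> exp (2::real)"
  proof -
    have "2 * 2 \<le> exp (1::real) * exp 1" by (rule mult_mono) (use e1 in auto)
    then show ?thesis by (simp add: exp_add[symmetric])
  qed
  have "(4::real) ^ (N * (2 * k + 7)) \<le> exp 2 ^ (N * (2 * k + 7))"
    using e2 by (intro power_mono) auto
  also have "\<dots> = exp (2 * real (N * (2 * k + 7)))"
    by (simp add: exp_of_nat_mult[symmetric] mult.commute)
  finally have "(4::real) ^ (N * (2 * k + 7)) * (2 * exp (- y))
      \<le> exp (2 * real (N * (2 * k + 7))) * (exp 1 * exp (- y))"
    using e1 by (intro mult_mono) auto
  also have "\<dots> = exp (2 * real N * (2 * real k + 7) + 1 - y)"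
    by (simp add: exp_add[symmetric] exp_diff exp_minus field_simps)
  also have "\<dots> \<le> exp (- (1 / \<delta>) - real (Suc k))"
  proof -
    define s where "s = 1 / \<delta>"
    have s: "1 \<le> s" using \<delta> by (simp add: s_def)
    then have "s * 1 \<le> s * s" by (intro mult_left_mono) auto
    then have ss: "s \<le> s\<^sup>2" by (simp add: power2_eq_square)
    \<comment> \<open>By Bernoulli, \<open>b\<close> is a linear lower bound for the growth
      \<open>(3/2) ^ k\<close>. The 18 is then split: 15 pays for the entropy
      \<open>2 * N * (2 * k + 7)\<close> and the extra 1, while 3 pays for
      \<open>1 / \<delta>\<close> and \<open>Suc k\<close>.\<close>
    define b where "b = 1 + real k / 2"
    have b: "b \<le> (3/2) ^ k"
      using Bernoulli_inequality[of "1/2" k] by (simp add: b_def)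
    have b1: "1 \<le> b" by (simp add: b_def)
    have n: "1 \<le> real N" using N by simp
    have Nb: "1 * b \<le> real N * b" using n b1 by (intro mult_right_mono) auto
    have Nb0: "0 \<le> real N * b" using b1 by simp
    have "y \<ge> 18 * real N * (3/2) ^ k * s\<^sup>2" using y by (simp add: s_def power_one_over)
    moreover have "18 * real N * (3/2) ^ k * s\<^sup>2 \<ge> 18 * real N * b * s\<^sup>2"
      using b by (intro mult_right_mono mult_left_mono) auto
    moreover have "15 * (real N * b) * 1 \<le> 15 * (real N * b) * s\<^sup>2"
      using Nb0 s ss by (intro mult_left_mono) auto
    moreover have "3 * (real N * b) * s \<le> 3 * (real N * b) * s\<^sup>2"
      using Nb0 ss by (intro mult_left_mono) auto
    moreover have "3 * b * s \<le> 3 * (real N * b) * s"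
      using Nb s by (intro mult_right_mono) auto
    moreover have "3 * b * s = s + (3 * b - 1) * s" by (simp add: algebra_simps)
    moreover have "(3 * b - 1) * 1 \<le> (3 * b - 1) * s"
      using b1 s by (intro mult_left_mono) auto
    moreover have "15 * (real N * b) = 2 * real N * (2 * real k + 7) + real N * (1 + 7 / 2 * real k)"
      by (simp add: b_def algebra_simps)
    moreover have "1 * 1 \<le> real N * (1 + 7 / 2 * real k)" using n by (intro mult_mono) auto
    ultimately have "y \<ge> 2 * real N * (2 * real k + 7) + 1 + s + (3 * b - 1)"
      by (simp add: mult_ac)
    then have "2 * real N * (2 * real k + 7) + 1 - y \<le> - s - real (Suc k)"
      by (simp add: b_def)
    then show ?thesis by (simp add: s_def)
  qed
  also have "\<dots> = exp (- (1 / \<delta>)) * exp (- 1) ^ Suc k"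
    by (simp add: exp_of_nat_mult[symmetric] exp_add[symmetric] exp_diff exp_minus field_simps)
  also have "\<dots> \<le> \<delta> * (1/2) ^ Suc k"
  proof (intro mult_mono power_mono)
    have "1 / \<delta> \<le> exp (1 / \<delta>)" using exp_ge_add_one_self[of "1 / \<delta>"] by linarith
    then show "exp (- (1 / \<delta>)) \<le> \<delta>" using \<delta> by (simp add: exp_minus field_simps)
    show "exp (- 1) \<le> (1/2 :: real)" using e1 by (simp add: exp_minus field_simps)
  qed (use \<delta> in auto)
  finally show ?thesis by (simp add: power_add[symmetric] algebra_simps)
qed

lemma net_tendsto:
  fixes a :: "nat \<Rightarrow> real"
  assumes "\<And>k. \<bar>b - a k\<bar> \<le> H / 2 ^ k"
  shows "a \<longlonglongrightarrow> b"
proof -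
  have "(\<lambda>k. H * (1/2) ^ k) \<longlonglongrightarrow> H * 0"
    by (intro tendsto_intros LIMSEQ_power_zero) auto
  then have "(\<lambda>k. H / 2 ^ k) \<longlonglongrightarrow> 0" by (simp add: power_one_over)
  moreover have "\<forall>\<^sub>F k in sequentially. norm (a k - b) \<le> H / 2 ^ k"
    using assms by (simp add: abs_minus_commute)
  ultimately have "(\<lambda>k. a k - b) \<longlonglongrightarrow> 0" by (rule Lim_null_comparison[rotated])
  then show ?thesis by (simp add: LIM_zero_iff)
qed

text \<open>The bad events have total probability at most \<delta>, and off them the links telescope
  to a bound for every net point, which passes to limits and so to all of \<open>F\<close>. A
  measurable \<open>G\<close> is produced because the event quantified over the possibly uncountable
  \<open>F\<close> is not evidently measurable.\<close>

lemma (in prob_space) chaining: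
  fixes F :: "('a \<Rightarrow> real) set" and T :: "nat \<Rightarrow> ('a \<Rightarrow> real) set"
  assumes meas: "\<And>f. f \<in> F \<Longrightarrow> f \<in> borel_measurable M"
    and bound: "\<And>f x. f \<in> F \<Longrightarrow> x \<in> space M \<Longrightarrow> \<bar>f x\<bar> \<le> H"
    and moment: "\<And>f. f \<in> F \<Longrightarrow> expectation (\<lambda>x. \<bar>f x\<bar> powr q) \<le> 1"
    and zero: "(\<lambda>_. 0) \<in> F"
    and net: "\<And>k. T k \<subseteq> F" "\<And>k. finite (T k)" "\<And>k. card (T k) \<le> 4 ^ (N * (k + 3))"
      "\<And>k f. f \<in> F \<Longrightarrow> \<exists>g\<in>T k. \<forall>x\<in>space M. \<bar>f x - g x\<bar> \<le> H / 2 ^ k"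
    and q: "2 \<le> q" and H: "0 < H" and N: "1 \<le> N" and \<delta>: "0 < \<delta>" "\<delta> < 1"
    and m: "36864 * q\<^sup>2 * H powr q * real N / \<delta>\<^sup>2 \<le> real m"
  shows "\<exists>G\<in>sets (PiM {..<m} (\<lambda>_. M)). 1 - \<delta> \<le> measure (PiM {..<m} (\<lambda>_. M)) G \<and>
           (\<forall>\<xi>\<in>G. \<forall>f\<in>F.
             \<bar>(\<Sum>j<m. \<bar>f (\<xi> j)\<bar> powr q) - real m * expectation (\<lambda>x. \<bar>f x\<bar> powr q)\<bar> \<le> real m / 2)"
proof -
  let ?P = "PiM {..<m} (\<lambda>_. M)"
  interpret P: prob_space ?P by (intro prob_space_PiM prob_space_axioms)
  define A where "A = q\<^sup>2 * H powr q"
  have A: "0 < A" using q H by (simp add: A_def)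
  \<comment> \<open>At level 0 the single point 0 is already a net, as \<open>F\<close> is bounded
    by \<open>H\<close>. Chains then start where \<open>dev\<close> vanishes, and no initial term
    has to be estimated.\<close>
  define T' where "T' = (\<lambda>k. if k = 0 then {\<lambda>_. 0} else T k)"
  have T'_F: "T' k \<subseteq> F" and T'_fin: "finite (T' k)" and T'_card: "card (T' k) \<le> 4 ^ (N * (k + 3))" for k
    using net(1-3)[of k] zero by (auto simp: T'_def)
  have T'_net: "\<exists>g\<in>T' k. \<forall>x\<in>space M. \<bar>f x - g x\<bar> \<le> H / 2 ^ k" if "f \<in> F" for f k
    using net(4)[OF that, of k] bound[OF that] by (auto simp: T'_def)
  define dev where "dev = (\<lambda>(f :: 'a \<Rightarrow> real) \<xi>. (\<Sum>j<m. \<bar>f (\<xi> j)\<bar> powr q) - real m * expectation (\<lambda>x. \<bar>f x\<bar> powr q))"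
  have int: "integrable M (\<lambda>x. \<bar>f x\<bar> powr q)" if "f \<in> F" for f
    using that q meas bound by (intro integrable_abs_powr) auto
  define t where "t = (\<lambda>k::nat. (3/4) ^ k / 8 :: real)"
  define E where "E = (\<lambda>k f g. {\<xi> \<in> space ?P. real m * t k \<le> \<bar>dev f \<xi> - dev g \<xi>\<bar>})"
  define pairs where "pairs = (\<lambda>k. {(f, g). f \<in> T' k \<and> g \<in> T' (Suc k) \<and>
    (\<forall>x\<in>space M. \<bar>f x - g x\<bar> \<le> 2 * H / 2 ^ k)})"
  have dev_meas: "dev f \<in> borel_measurable ?P" if "f \<in> F" for f
  proof -
    have [measurable]: "f \<in> borel_measurable M" by (rule meas[OF that])
    show ?thesis unfolding dev_def by measurable
  qed
  have E_sets: "E k f g \<in> sets ?P" if "f \<in> F" "g \<in> F" for k f g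
  proof -
    have [measurable]: "dev f \<in> borel_measurable ?P" "dev g \<in> borel_measurable ?P"
      using that dev_meas by auto
    show ?thesis unfolding E_def by measurable
  qed
  have E_prob: "P.prob (E k f g) \<le> 2 * exp (- (real m / A * (3/2) ^ k / 2048))"
    if f: "f \<in> F" and g: "g \<in> F" and fg: "\<forall>x\<in>space M. \<bar>f x - g x\<bar> \<le> 2 * H / 2 ^ k" for k f g
  proof -
    define D where "D = 2 * H / 2 ^ k"
    \<comment> \<open>The variance bound is \<open>8 * A / 4 ^ k\<close>, so the unconstrained
      optimum would be \<open>3 ^ k / (128 * A)\<close>. For large \<open>k\<close> that breaks the
      boundedness condition, so the growth is lowered to \<open>2 ^ k\<close>, with the constant of
      the optimum at \<open>k = 0\<close>.\<close>
    define l where "l = 2 ^ k / (128 * A)"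
    define h where "h = (\<lambda>x. \<bar>f x\<bar> powr q - \<bar>g x\<bar> powr q)"
    have H1: "H * H powr (q - 1) = H powr q"
      using H powr_add[of H 1 "q - 1"] by simp
    have H2: "H\<^sup>2 * H powr (q - 2) = H powr q"
      using H powr_add[of H 2 "q - 2"] by (simp add: powr_numeral)
    have "2 * (q * D * H powr (q - 1)) * l = 4 * q * (H * H powr (q - 1)) * (l / 2 ^ k)"
      by (simp add: D_def)
    also have "\<dots> = 1 / (32 * q)"
      using H q unfolding H1 by (simp add: l_def A_def power2_eq_square)
    also have "\<dots> \<le> 1" using q by simp
    finally have l1: "2 * (q * D * H powr (q - 1)) * l \<le> 1" .
    have "dev f \<xi> - dev g \<xi> = (\<Sum>j<m. h (\<xi> j) - expectation h)" for \<xi>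
      using int[OF f] int[OF g] by (simp add: dev_def h_def sum_subtractf sum.distrib algebra_simps)
    then have "P.prob (E k f g) = P.prob {\<xi> \<in> space ?P. real m * t k \<le> \<bar>\<Sum>j<m. h (\<xi> j) - expectation h\<bar>}"
      by (simp add: E_def)
    also have "\<dots> \<le> 2 * exp (- (l * (real m * t k)) + real m * (l\<^sup>2 * (2 * q\<^sup>2 * D\<^sup>2 * H powr (q - 2))))"
      unfolding h_def
      by (rule increment_tail) (use f g meas bound moment fg q l1 A in \<open>auto simp: D_def l_def\<close>)
    also have "\<dots> \<le> 2 * exp (- (real m / A * (3/2) ^ k / 2048))"
    proof -
      have "(2::real) ^ k * (3/4) ^ k = (3/2) ^ k" by (simp add: power_mult_distrib[symmetric])
      moreover have "l * (real m * t k) = real m / A * (2 ^ k * (3/4) ^ k) / 1024"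
        by (simp add: l_def t_def mult_ac)
      ultimately have "l * (real m * t k) = real m / A * (3/2) ^ k / 1024" by simp
      moreover have "real m * (l\<^sup>2 * (2 * q\<^sup>2 * D\<^sup>2 * H powr (q - 2))) = real m / A / 2048"
      proof -
        have "l\<^sup>2 * D\<^sup>2 = (2 * H / (128 * A))\<^sup>2"
          by (simp add: l_def D_def power_mult_distrib[symmetric])
        also have "\<dots> = H\<^sup>2 * (2 / (128 * A))\<^sup>2"
          by (simp add: power_mult_distrib power_divide)
        finally have lD: "l\<^sup>2 * D\<^sup>2 = H\<^sup>2 * (2 / (128 * A))\<^sup>2" .
        have "l\<^sup>2 * (2 * q\<^sup>2 * D\<^sup>2 * H powr (q - 2)) = 2 * q\<^sup>2 * H powr (q - 2) * (l\<^sup>2 * D\<^sup>2)"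
          by (simp only: mult_ac)
        also have "\<dots> = 2 * q\<^sup>2 * (H\<^sup>2 * H powr (q - 2)) * (2 / (128 * A))\<^sup>2"
          unfolding lD by (simp only: mult_ac)
        also have "\<dots> = 2 * A * (2 / (128 * A))\<^sup>2" unfolding H2 by (simp add: A_def)
        also have "\<dots> = 1 / (2048 * A)" using A by (simp add: power2_eq_square field_simps)
        finally show ?thesis by simp
      qed
      \<comment> \<open>The quadratic term does not depend on \<open>k\<close> and is half of the
        linear one at \<open>k = 0\<close>, so at every level at least half of the linear term
        survives.\<close>
      moreover have "real m / A \<le> real m / A * (3/2) ^ k"
        using A mult_left_mono[of 1 "(3/2) ^ k" "real m / A"] by simp
      moreover have "- (X / 1024) + Y / 2048 \<le> - (X / 2048)" if "Y \<le> X" for X Y :: real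
        using that by linarith
      ultimately show ?thesis by (simp only: mult_le_cancel_left_pos zero_less_numeral exp_le_cancel_iff)
    qed
    finally show ?thesis .
  qed
  define Bad where "Bad = (\<lambda>k. \<Union>(f, g)\<in>pairs k. E k f g)"
  have pairs_fin: "finite (pairs k)" and pairs_card: "card (pairs k) \<le> 4 ^ (N * (k + 3)) * 4 ^ (N * (k + 4))" for k
  proof -
    have sub: "pairs k \<subseteq> T' k \<times> T' (Suc k)" by (auto simp: pairs_def)
    show "finite (pairs k)" by (rule finite_subset[OF sub]) (simp add: T'_fin)
    have "card (pairs k) \<le> card (T' k \<times> T' (Suc k))"
      by (rule card_mono[OF _ sub]) (simp add: T'_fin)
    also have "\<dots> \<le> 4 ^ (N * (k + 3)) * 4 ^ (N * (Suc k + 3))"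
      unfolding card_cartesian_product by (intro mult_mono T'_card) auto
    finally show "card (pairs k) \<le> 4 ^ (N * (k + 3)) * 4 ^ (N * (k + 4))" by (simp add: add.commute)
  qed
  have pairs_F: "f \<in> F" "g \<in> F" if "(f, g) \<in> pairs k" for f g k
    using that T'_F[of k] T'_F[of "Suc k"] by (auto simp: pairs_def)
  have Bad_sets: "Bad k \<in> sets ?P" for k
    unfolding Bad_def using pairs_fin[of k] pairs_F by (intro sets.finite_UN) (auto intro!: E_sets)
  have Bad_prob: "P.prob (Bad k) \<le> \<delta> * (1/2) ^ Suc k" for k
  proof -
    let ?y = "real m / A * (3/2) ^ k / 2048"
    have "P.prob (Bad k) \<le> (\<Sum>p\<in>pairs k. P.prob (case p of (f, g) \<Rightarrow> E k f g))"
      unfolding Bad_def using pairs_fin[of k] pairs_F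
      by (intro P.finite_measure_subadditive_finite) (auto intro!: E_sets)
    also have "\<dots> \<le> (\<Sum>p\<in>pairs k. 2 * exp (- ?y))"
    proof (rule sum_mono)
      fix p assume "p \<in> pairs k"
      then obtain f g where p: "p = (f, g)" and fg: "(f, g) \<in> pairs k" by (cases p) auto
      then have "\<forall>x\<in>space M. \<bar>f x - g x\<bar> \<le> 2 * H / 2 ^ k" by (simp add: pairs_def)
      from E_prob[OF pairs_F[OF fg] this] show "P.prob (case p of (f, g) \<Rightarrow> E k f g) \<le> 2 * exp (- ?y)"
        by (simp only: p prod.case)
    qed
    also have "\<dots> = real (card (pairs k)) * (2 * exp (- ?y))" by simp
    also have "\<dots> \<le> real (4 ^ (N * (k + 3)) * 4 ^ (N * (k + 4))) * (2 * exp (- ?y))"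
      by (intro mult_right_mono of_nat_mono pairs_card) auto
    also have "\<dots> \<le> \<delta> * (1/2) ^ Suc k"
    proof -
      \<comment> \<open>Dividing 36864 by the 2048 of the increment bound leaves the 18 required by
        \<open>chaining_level_bound\<close>.\<close>
      have "36864 * real N / \<delta>\<^sup>2 \<le> real m / A"
        using m A by (simp add: A_def pos_le_divide_eq mult_ac)
      then have "36864 * real N / \<delta>\<^sup>2 * ((3/2) ^ k / 2048) \<le> real m / A * ((3/2) ^ k / 2048)"
        by (rule mult_right_mono) simp
      then have "18 * real N * (3/2) ^ k / \<delta>\<^sup>2 \<le> ?y" by simp
      from chaining_level_bound[OF N \<delta> this] show ?thesis by simp
    qed
    finally show ?thesis .
  qed
  have sums: "(\<lambda>k. \<delta> * (1/2) ^ Suc k) sums \<delta>"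
    using sums_mult[OF power_half_series, of \<delta>] by simp
  have summable_Bad: "summable (\<lambda>k. P.prob (Bad k))"
    by (rule summable_comparison_test'[OF sums_summable[OF sums], of 0]) (use Bad_prob in auto)
  have "P.prob (\<Union>k. Bad k) \<le> (\<Sum>k. P.prob (Bad k))"
    using Bad_sets by (intro P.finite_measure_subadditive_countably summable_Bad) auto
  also have "\<dots> \<le> (\<Sum>k. \<delta> * (1/2) ^ Suc k)"
    by (intro suminf_le Bad_prob summable_Bad sums_summable[OF sums])
  also have "\<dots> = \<delta>" using sums by (simp add: sums_iff)
  finally have prob_Bad: "P.prob (\<Union>k. Bad k) \<le> \<delta>" .
  define G where "G = space ?P - (\<Union>k. Bad k)"
  have UBad_sets: "(\<Union>k. Bad k) \<in> sets ?P" using Bad_sets by auto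
  have "\<bar>dev f \<xi>\<bar> \<le> real m / 2" if \<xi>: "\<xi> \<in> G" and f: "f \<in> F" for \<xi> f
  proof -
    have \<xi>_sp: "\<xi> j \<in> space M" if "j < m" for j
      using \<xi> that by (auto simp: G_def space_PiM)
    obtain F' where F': "\<And>k. F' k \<in> T' k" "\<And>k x. x \<in> space M \<Longrightarrow> \<bar>f x - F' k x\<bar> \<le> H / 2 ^ k"
      using T'_net[OF f] by metis
    have F'_F: "F' k \<in> F" for k using F'(1)[of k] T'_F[of k] by blast
    have in_pairs: "(F' k, F' (Suc k)) \<in> pairs k" for k
    proof -
      have "\<bar>F' k x - F' (Suc k) x\<bar> \<le> 2 * H / 2 ^ k" if "x \<in> space M" for x
      proof -
        have "H / 2 ^ Suc k \<le> H / 2 ^ k" using H by (intro divide_left_mono) auto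
        then show ?thesis using F'(2)[OF that, of k] F'(2)[OF that, of "Suc k"] by linarith
      qed
      then show ?thesis using F'(1) by (simp add: pairs_def)
    qed
    have step: "\<bar>dev (F' k) \<xi> - dev (F' (Suc k)) \<xi>\<bar> \<le> real m * t k" for k
      using \<xi> in_pairs[of k] by (fastforce simp: G_def Bad_def E_def)
    have partial: "\<bar>dev (F' k) \<xi>\<bar> \<le> real m * (\<Sum>i<k. t i)" for k
    proof (induction k)
      case 0
      have "F' 0 = (\<lambda>_. 0)" using F'(1)[of 0] by (simp add: T'_def)
      then show ?case by (simp add: dev_def)
    next
      case (Suc k)
      then show ?case using step[of k] by (simp add: distrib_left)
    qed
    have "(\<Sum>i<k. t i) \<le> 1/2" for k
    proof -
      have "(\<Sum>i<k. t i) = (1 - (3/4) ^ k) / 2"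
        by (induction k) (simp_all add: t_def field_simps)
      then show ?thesis by simp
    qed
    then have half: "real m * (\<Sum>i<k. t i) \<le> real m * (1/2)" for k
      by (intro mult_left_mono) auto
    have bnd: "\<bar>dev (F' k) \<xi>\<bar> \<le> real m / 2" for k
      using partial[of k] half[of k] by linarith
    have lim: "(\<lambda>k. F' k x) \<longlonglongrightarrow> f x" if "x \<in> space M" for x
      using F'(2)[OF that] by (rule net_tendsto)
    have "(\<lambda>k. dev (F' k) \<xi>) \<longlonglongrightarrow> dev f \<xi>"
      unfolding dev_def
      using lim \<xi>_sp q bound[OF F'_F] meas[OF F'_F] meas[OF f]
      by (intro tendsto_intros expectation_abs_powr_tendsto[where H = H] tendsto_powr') auto
    then have "(\<lambda>k. \<bar>dev (F' k) \<xi>\<bar>) \<longlonglongrightarrow> \<bar>dev f \<xi>\<bar>" by (rule tendsto_rabs)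
    then show ?thesis by (rule LIMSEQ_le_const2) (use bnd in auto)
  qed
  moreover have "1 - \<delta> \<le> P.prob G"
    unfolding G_def using prob_Bad by (simp add: P.prob_compl[OF UBad_sets])
  moreover have "G \<in> sets ?P" unfolding G_def using UBad_sets by auto
  ultimately show ?thesis unfolding dev_def by blast
qed

section \<open>From the unit ball to the whole space\<close>

text \<open>Both inequalities are homogeneous of degree \<open>q\<close>, so it suffices to treat
  functions whose q-th moment is 1, where a deviation of \<open>m / 2\<close> gives the factors 1/2
  and 3/2. If the moment is 0, the hypothesis \<open>nikolskii\<close> forces the function to
  vanish. Chaining runs over the whole unit ball because chains start at 0.\<close>

lemma (in prob_space) sampling_discretization:
  fixes X :: "('a \<Rightarrow> real) set" and m :: nat
  assumes meas: "\<And>f. f \<in> X \<Longrightarrow> f \<in> borel_measurable M"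
    and zero: "(\<lambda>_. 0) \<in> X" and scale: "\<And>f c. f \<in> X \<Longrightarrow> (\<lambda>x. c * f x) \<in> X"
    and basis: "lagrange_basis (space M) X n p u \<kappa>" and n: "n \<le> N"
    and nikolskii: "\<And>f x. f \<in> X \<Longrightarrow> x \<in> space M \<Longrightarrow>
      \<bar>f x\<bar> \<le> H * expectation (\<lambda>x. \<bar>f x\<bar> powr q) powr (1/q)"
    and q: "2 \<le> q" and H: "0 < H" and N: "1 \<le> N" and \<delta>: "0 < \<delta>" "\<delta> < 1"
    and m: "36864 * q\<^sup>2 * H powr q * real N / \<delta>\<^sup>2 \<le> real m"
  shows "1 - \<delta> \<le> measure (PiM {..<m} (\<lambda>_. M))
    {\<xi> \<in> space (PiM {..<m} (\<lambda>_. M)). \<forall>f\<in>X.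
       1/2 * expectation (\<lambda>x. \<bar>f x\<bar> powr q) \<le> (\<Sum>j<m. \<bar>f (\<xi> j)\<bar> powr q) / real m \<and>
       (\<Sum>j<m. \<bar>f (\<xi> j)\<bar> powr q) / real m \<le> 3/2 * expectation (\<lambda>x. \<bar>f x\<bar> powr q)}"
proof -
  let ?P = "PiM {..<m} (\<lambda>_. M)"
  interpret P: prob_space ?P by (intro prob_space_PiM prob_space_axioms)
  interpret lagrange_basis "space M" X n p u \<kappa> by (rule basis)
  define I where "I = (\<lambda>f. expectation (\<lambda>x. \<bar>f x\<bar> powr q))"
  define S where "S = (\<lambda>(f :: 'a \<Rightarrow> real) \<xi>. (\<Sum>j<m. \<bar>f (\<xi> j)\<bar> powr q) / real m)"
  define good where "good = (\<lambda>f \<xi>. 1/2 * I f \<le> S f \<xi> \<and> S f \<xi> \<le> 3/2 * I f)"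
  have I_nonneg: "0 \<le> I f" for f by (simp add: I_def)
  have m_pos: "0 < real m"
  proof -
    have "0 < 36864 * q\<^sup>2 * H powr q * real N / \<delta>\<^sup>2" using q H N \<delta> by simp
    then show ?thesis using m by linarith
  qed
  have I_scale: "I (\<lambda>x. c * f x) = c powr q * I f" if "0 \<le> c" for c f
    using that by (simp add: I_def abs_mult powr_mult)
  have S_scale: "S (\<lambda>x. c * f x) \<xi> = c powr q * S f \<xi>" if "0 \<le> c" for c f \<xi>
    using that by (simp add: S_def abs_mult powr_mult sum_distrib_left)
  have good_all: "good f \<xi>"
    if \<xi>: "\<xi> \<in> space ?P" and norm: "\<And>g. g \<in> X \<Longrightarrow> I g = 1 \<Longrightarrow> good g \<xi>" and f: "f \<in> X" for f \<xi>
  proof (cases "I f = 0")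
    case True
    have "f (\<xi> j) = 0" if "j < m" for j
    proof -
      have "\<xi> j \<in> space M" using \<xi> that by (auto simp: space_PiM)
      then show ?thesis using nikolskii[OF f, of "\<xi> j"] True by (simp add: I_def)
    qed
    then show ?thesis using True by (simp add: good_def S_def)
  next
    case False
    then have I: "0 < I f" using I_nonneg[of f] by simp
    define c where "c = (1 / I f) powr (1/q)"
    have c: "0 \<le> c" "c powr q = 1 / I f" using I q by (simp_all add: c_def powr_powr)
    have "good (\<lambda>x. c * f x) \<xi>"
      using I c by (intro norm scale f) (simp add: I_scale)
    then show ?thesis
      using I c by (simp add: good_def I_scale S_scale field_simps)
  qed
  define F where "F = {f \<in> X. I f \<le> 1}"
  have F_X: "F \<subseteq> X" by (auto simp: F_def)
  have F_bound: "\<bar>f x\<bar> \<le> H" if "f \<in> F" "x \<in> space M" for f x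
  proof -
    have "\<bar>f x\<bar> \<le> H * I f powr (1/q)" using nikolskii[of f x] that by (simp add: F_def I_def)
    also have "\<dots> \<le> H * 1"
      using that H q I_nonneg[of f] by (intro mult_left_mono powr_le1) (auto simp: F_def)
    finally show ?thesis by simp
  qed
  have "\<exists>T\<subseteq>F. finite T \<and> card T \<le> 4 ^ (n * (k + 3)) \<and>
      (\<forall>f\<in>F. \<exists>g\<in>T. \<forall>x\<in>space M. \<bar>f x - g x\<bar> \<le> H / 2 ^ k)" for k
    using F_X H F_bound by (rule exists_net)
  then obtain T where T: "\<And>k. T k \<subseteq> F" "\<And>k. finite (T k)" "\<And>k. card (T k) \<le> 4 ^ (n * (k + 3))"
    "\<And>k f. f \<in> F \<Longrightarrow> \<exists>g\<in>T k. \<forall>x\<in>space M. \<bar>f x - g x\<bar> \<le> H / 2 ^ k"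
    by metis
  have T_card: "card (T k) \<le> 4 ^ (N * (k + 3))" for k
  proof -
    have "(4::nat) ^ (n * (k + 3)) \<le> 4 ^ (N * (k + 3))"
      using n by (intro power_increasing mult_right_mono) auto
    then show ?thesis using T(3)[of k] by (rule order_trans[rotated])
  qed
  have "\<exists>G\<in>sets ?P. 1 - \<delta> \<le> P.prob G \<and> (\<forall>\<xi>\<in>G. \<forall>f\<in>F.
      \<bar>(\<Sum>j<m. \<bar>f (\<xi> j)\<bar> powr q) - real m * expectation (\<lambda>x. \<bar>f x\<bar> powr q)\<bar> \<le> real m / 2)"
  proof (rule chaining[where T = T and H = H and N = N])
    show "(\<lambda>_. 0) \<in> F" using zero by (simp add: F_def I_def)
  qed (use meas F_X F_bound T T_card q H N \<delta> m in \<open>auto simp: F_def I_def\<close>)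
  then obtain G where G: "G \<in> sets ?P" "1 - \<delta> \<le> P.prob G"
    and dev: "\<And>\<xi> f. \<xi> \<in> G \<Longrightarrow> f \<in> F \<Longrightarrow> \<bar>(\<Sum>j<m. \<bar>f (\<xi> j)\<bar> powr q) - real m * I f\<bar> \<le> real m / 2"
    unfolding I_def by blast
  let ?E = "{\<xi> \<in> space ?P. \<forall>f\<in>X. good f \<xi>}"
  have "G \<subseteq> ?E"
  proof (clarify, intro conjI ballI)
    fix \<xi> assume \<xi>: "\<xi> \<in> G"
    show sp: "\<xi> \<in> space ?P" using \<xi> sets.sets_into_space[OF G(1)] by blast
    fix f assume f: "f \<in> X"
    show "good f \<xi>"
    proof (rule good_all[OF sp _ f])
      fix g assume g: "g \<in> X" "I g = 1"
      then have "\<bar>real m * S g \<xi> - real m\<bar> \<le> real m / 2"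
        using dev[OF \<xi>, of g] m_pos by (simp add: F_def S_def)
      then have "real m * (1/2) \<le> real m * S g \<xi>" "real m * S g \<xi> \<le> real m * (3/2)"
        by linarith+
      then have "1/2 \<le> S g \<xi>" "S g \<xi> \<le> 3/2"
        using m_pos mult_left_le_imp_le by blast+
      then show "good g \<xi>" using g by (simp add: good_def)
    qed
  qed
  moreover have "?E \<in> sets ?P"
  proof -
    \<comment> \<open>The quantifier over the uncountable set \<open>X\<close> may be restricted to the union of the nets,
      which is countable and dense in the unit ball.\<close>
    have "?E = {\<xi> \<in> space ?P. \<forall>f\<in>\<Union>(range T). good f \<xi>}"
    proof (intro Collect_cong conj_cong refl iffI ballI)
      fix \<xi> f assume "\<forall>f\<in>X. good f \<xi>" "f \<in> \<Union>(range T)"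
      then show "good f \<xi>" using T(1) F_X by blast
    next
      fix \<xi> f assume \<xi>: "\<xi> \<in> space ?P" and net: "\<forall>f\<in>\<Union>(range T). good f \<xi>" and f: "f \<in> X"
      show "good f \<xi>"
      proof (rule good_all[OF \<xi> _ f])
        fix g assume "g \<in> X" "I g = 1"
        then have gF: "g \<in> F" by (simp add: F_def)
        obtain F' where F': "\<And>k. F' k \<in> T k" "\<And>k x. x \<in> space M \<Longrightarrow> \<bar>g x - F' k x\<bar> \<le> H / 2 ^ k"
          using T(4)[OF gF] by metis
        have F'_F: "F' k \<in> F" for k using F'(1)[of k] T(1)[of k] by blast
        have lim: "(\<lambda>k. F' k x) \<longlonglongrightarrow> g x" if "x \<in> space M" for x
          using F'(2)[OF that] by (rule net_tendsto)
        have limI: "(\<lambda>k. I (F' k)) \<longlonglongrightarrow> I g"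
          unfolding I_def using lim q F_bound[OF F'_F] meas[OF subsetD[OF F_X F'_F]] meas[OF subsetD[OF F_X gF]]
          by (intro expectation_abs_powr_tendsto[where H = H]) auto
        have limS: "(\<lambda>k. S (F' k) \<xi>) \<longlonglongrightarrow> S g \<xi>"
          unfolding S_def using lim \<xi> q m_pos
          by (intro tendsto_intros tendsto_powr') (auto simp: space_PiM)
        have "good (F' k) \<xi>" for k using net F'(1) by blast
        then show "good g \<xi>"
          unfolding good_def
          using LIMSEQ_le[OF tendsto_mult_left[OF limI, of "1/2"] limS]
            LIMSEQ_le[OF limS tendsto_mult_left[OF limI, of "3/2"]] by blast
      qed
    qed
    also have "\<dots> \<in> sets ?P"
    proof (rule sets.sets_Collect_countable_All')
      show "countable (\<Union>(range T))" using T(2) by (auto intro: countable_finite)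
      fix f assume "f \<in> \<Union>(range T)"
      then have [measurable]: "f \<in> borel_measurable M" using T(1) F_X meas by blast
      show "{\<xi> \<in> space ?P. good f \<xi>} \<in> sets ?P"
        unfolding good_def S_def by measurable
    qed
    finally show ?thesis .
  qed
  ultimately have "P.prob G \<le> P.prob ?E" by (rule P.finite_measure_mono)
  then show ?thesis using G(2) by (simp add: good_def I_def S_def)
qed

section \<open>Continuous functions on a compact set\<close>

theorem theorem4p2:
  shows "\<exists>c::real. c > 0 \<and>
    (\<forall>(d::nat) (\<Omega>::(nat \<Rightarrow> real) set) (\<mu>::(nat \<Rightarrow> real) measure)
       (X::((nat \<Rightarrow> real) \<Rightarrow> real) set) (N::nat) (q::real) (H::real) (\<delta>::real) (m::nat).
       \<Omega> \<subseteq> {x. \<forall>i\<ge>d. x i = 0} \<and> compact \<Omega> \<and>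
       prob_space \<mu> \<and> space \<mu> = \<Omega> \<and> sets \<mu> = sets (restrict_space borel \<Omega>) \<and>
       (\<forall>f\<in>X. continuous_on \<Omega> f \<and> (\<forall>x. x \<notin> \<Omega> \<longrightarrow> f x = 0)) \<and> dim_subspace X N \<and>
       2 \<le> q \<and> 0 < H \<and>
       (\<forall>f\<in>X. (SUP x\<in>\<Omega>. \<bar>f x\<bar>) \<le> H * (\<integral>x. \<bar>f x\<bar> powr q \<partial>\<mu>) powr (1/q)) \<and>
       0 < \<delta> \<and> \<delta> < 1 \<and>
       real m \<ge> c * \<delta> powr (-2) * q\<^sup>2 * H powr q * real N
     \<longrightarrow>
       measure (PiM {..<m} (\<lambda>_. \<mu>))
         {\<xi> \<in> space (PiM {..<m} (\<lambda>_. \<mu>)). \<forall>f\<in>X.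
            1/2 * (\<integral>x. \<bar>f x\<bar> powr q \<partial>\<mu>) \<le> (\<Sum>j<m. \<bar>f (\<xi> j)\<bar> powr q) / real m \<and>
            (\<Sum>j<m. \<bar>f (\<xi> j)\<bar> powr q) / real m \<le> 3/2 * (\<integral>x. \<bar>f x\<bar> powr q \<partial>\<mu>)}
         \<ge> 1 - \<delta> \<and>
       (\<exists>\<xi>::nat \<Rightarrow> (nat \<Rightarrow> real). (\<forall>j<m. \<xi> j \<in> \<Omega>) \<and> (\<forall>f\<in>X.
            1/2 * (\<integral>x. \<bar>f x\<bar> powr q \<partial>\<mu>) \<le> (\<Sum>j<m. \<bar>f (\<xi> j)\<bar> powr q) / real m \<and>
            (\<Sum>j<m. \<bar>f (\<xi> j)\<bar> powr q) / real m \<le> 3/2 * (\<integral>x. \<bar>f x\<bar> powr q \<partial>\<mu>))))"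
proof (rule exI[of _ 36864], intro conjI allI impI; (elim conjE)?)
  fix d :: nat and \<Omega> :: "(nat \<Rightarrow> real) set" and \<mu> :: "(nat \<Rightarrow> real) measure"
    and X :: "((nat \<Rightarrow> real) \<Rightarrow> real) set" and N :: nat and q H \<delta> :: real and m :: nat
  assume compact: "compact \<Omega>" and prob: "prob_space \<mu>"
    and space: "space \<mu> = \<Omega>" and sets: "sets \<mu> = sets (restrict_space borel \<Omega>)"
    and X: "\<forall>f\<in>X. continuous_on \<Omega> f \<and> (\<forall>x. x \<notin> \<Omega> \<longrightarrow> f x = 0)" and dim: "dim_subspace X N"
    and q: "2 \<le> q" and H: "0 < H"
    and sup: "\<forall>f\<in>X. (SUP x\<in>\<Omega>. \<bar>f x\<bar>) \<le> H * (\<integral>x. \<bar>f x\<bar> powr q \<partial>\<mu>) powr (1/q)"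
    and \<delta>: "0 < \<delta>" "\<delta> < 1"
    and m: "36864 * \<delta> powr (-2) * q\<^sup>2 * H powr q * real N \<le> real m"
  let ?P = "PiM {..<m} (\<lambda>_. \<mu>)"
  let ?E = "{\<xi> \<in> space ?P. \<forall>f\<in>X.
      1/2 * (\<integral>x. \<bar>f x\<bar> powr q \<partial>\<mu>) \<le> (\<Sum>j<m. \<bar>f (\<xi> j)\<bar> powr q) / real m \<and>
      (\<Sum>j<m. \<bar>f (\<xi> j)\<bar> powr q) / real m \<le> 3/2 * (\<integral>x. \<bar>f x\<bar> powr q \<partial>\<mu>)}"
  interpret V: vector_space fscale by (rule vector_space_fscale)
  interpret prob_space \<mu> by (rule prob)
  interpret P: prob_space ?P by (intro prob_space_PiM prob)
  obtain B where B: "finite B" "card B = N" "V.span B = X"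
    using dim by (auto simp: dim_subspace_def)
  show E: "1 - \<delta> \<le> measure ?P ?E"
  proof (cases "N = 0")
    case True
    \<comment> \<open>For \<open>N = 0\<close> the condition on \<open>m\<close> permits
      \<open>m = 0\<close>, so this case is separate; all quantities are 0 for the zero function,
      also under division by 0.\<close>
    then have "X = {\<lambda>_. 0}" using B by (simp add: zero_fun_def)
    then have "?E = space ?P" by simp
    then show ?thesis using \<delta> by (simp add: P.prob_space)
  next
    case False
    obtain n p u where n: "n \<le> N" and u: "\<And>i. i < n \<Longrightarrow> u i \<in> X"
      and delta: "\<And>i j. i < n \<Longrightarrow> j < n \<Longrightarrow> u i (p j) = of_bool (i = j)"
      and repr: "\<And>f x. f \<in> X \<Longrightarrow> f x = (\<Sum>i<n. f (p i) * u i x)"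
      using span_lagrange_basis[OF B(1)] unfolding B by blast
    have bdd: "bdd_above ((\<lambda>x. \<bar>f x\<bar>) ` \<Omega>)" if "f \<in> X" for f
      using X that compact
      by (intro bounded_imp_bdd_above compact_imp_bounded compact_continuous_image continuous_intros) auto
    have "bdd_above ((\<lambda>x. \<Sum>i<n. \<bar>u i x\<bar>) ` \<Omega>)"
      using X u compact
      by (intro bounded_imp_bdd_above compact_imp_bounded compact_continuous_image continuous_intros) auto
    then obtain \<kappa> where \<kappa>: "\<And>x. x \<in> \<Omega> \<Longrightarrow> (\<Sum>i<n. \<bar>u i x\<bar>) \<le> \<kappa>"
      by (auto simp: bdd_above_def)
    have basis: "lagrange_basis (space \<mu>) X n p u (max 1 \<kappa>)"
    proof
      fix i assume i: "i < n"
      \<comment> \<open>The nodes were chosen among all points of the type. They lie in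
        \<open>\<Omega>\<close> because members of \<open>X\<close> vanish outside it and
        \<open>u i\<close> does not vanish at \<open>p i\<close>.\<close>
      have "u i (p i) \<noteq> 0" using delta[OF i i] by simp
      then show "p i \<in> space \<mu>" using X u[OF i] space by auto
    qed (use delta repr \<kappa> space in \<open>auto simp: le_max_iff_disj\<close>)
    show ?thesis
    proof (rule sampling_discretization[OF _ _ _ basis n _ q H _ \<delta>])
      show "f \<in> borel_measurable \<mu>" if "f \<in> X" for f
        using X that borel_measurable_continuous_on_restrict[of \<Omega> f]
          measurable_cong_sets[OF sets refl] by blast
      show "(\<lambda>_. 0) \<in> X" using V.span_zero[of B] B by (simp add: zero_fun_def)
      show "(\<lambda>x. c * f x) \<in> X" if "f \<in> X" for f c
        using V.span_scale[of f B c] that B by (simp add: fscale_def)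
      show "\<bar>f x\<bar> \<le> H * expectation (\<lambda>x. \<bar>f x\<bar> powr q) powr (1/q)"
        if "f \<in> X" "x \<in> space \<mu>" for f x
        using cSUP_upper[OF _ bdd[OF that(1)], of x] sup that space by force
      show "36864 * q\<^sup>2 * H powr q * real N / \<delta>\<^sup>2 \<le> real m"
        using m \<delta> by (simp add: powr_minus powr_numeral divide_inverse mult_ac)
    qed (use False in simp)
  qed
  have "?E \<noteq> {}"
  proof
    assume "?E = {}"
    then have "measure ?P ?E = 0" by (simp only: measure_empty)
    with E \<delta> show False by linarith
  qed
  then obtain \<xi> where "\<xi> \<in> ?E" by blast
  then show "\<exists>\<xi>::nat \<Rightarrow> (nat \<Rightarrow> real). (\<forall>j<m. \<xi> j \<in> \<Omega>) \<and> (\<forall>f\<in>X.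
      1/2 * (\<integral>x. \<bar>f x\<bar> powr q \<partial>\<mu>) \<le> (\<Sum>j<m. \<bar>f (\<xi> j)\<bar> powr q) / real m \<and>
      (\<Sum>j<m. \<bar>f (\<xi> j)\<bar> powr q) / real m \<le> 3/2 * (\<integral>x. \<bar>f x\<bar> powr q \<partial>\<mu>))"
    using space by (intro exI[of _ \<xi>]) (auto simp: space_PiM)
qed simp

end
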